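(* For all integers $p, q, n\ge 1$, $$Sr(n, p, q) \ =\ T(n+1, pq+1, q),$$ where $Sr(n,p,q)$ is the number of sets $F\subset\{1,\ldots,n\}$ with $F\in\mathcal{A}_q$ and $p\min F\ge |F|$, and $T(n+1,pq+1,q)$ denotes the number of edges of the graph $T(n+1,pq+1,q)$.
   Context: Notation: $\mathbb{N}=\{1,2,3,\ldots\}$ and $[n]=\{1,\ldots,n\}$. Schreier-type sets. For $q\ge 1$, let $$\mathcal{A}_q := \{F\subset\mathbb{N}: |F| = 1 \text{ or } F \text{ is an arithmetic progression with difference } q\}.$$ So the (finite, nonempty) members of $\mathcal{A}_q$ contained in $[n]$ are the sets of the form $\{a,a+q,\ldots,a+jq\}\subset[n]$ with $a\ge 1$, $j\ge 0$. For $n,p,q\ge 1$, $$Sr(n, p, q) := \#\{F\subset [n] : p\min F\ge |F| \text{ and } F\in \mathcal{A}_q\}.$$ The graph $T(n,r,q)$. Fix integers $r\ge 2$ (the number of parts) and $q\ge 1$. The graph $T(n,r,q)$ has $n$ vertices, distributed among $r$ parts (some possibly empty), and is defined recursively in $n$. The graph $T(1,r,q)$ has $r$ parts, exactly one of which contains a vertex (so there are no edges). Suppose $T(n,r,q)$ has been defined for some $n\ge 1$. Write $n=r\ell+k$ with integers $\ell\ge 0$ and $1\le k\le r$; then $k$ of the parts have $\ell+1$ vertices and $r-k$ of the parts have $\ell$ vertices. The graph $T(n+1,r,q)$ is obtained by adding a new vertex $v$ to one of the parts, and selecting a set $V$ of old vertices, as follows. - Case 1: if $k=r$, add $v$ to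 any one of the $r$ parts, and choose an arbitrary part $P$ among the remaining $r-1$ parts. Let $V$ consist of all old vertices in the same part as $v$ together with all vertices in all other parts except $P$ (i.e. all old vertices not in $P$). - Case 2: if $r-q<k<r$, add $v$ to a part with exactly $\ell$ vertices, and let $P$ be a part with $\ell+1$ vertices. Let $V$ consist of all old vertices in the same part as $v$ together with all vertices in all other parts except $P$ (i.e. all old vertices not in $P$). - Case 3: if $k\le r-q$ (and $k<r$), add $v$ to a part $P'$ with exactly $\ell$ vertices. Let $V$ consist of all vertices in all parts other than $P'$. Then list the vertices of $V$ in some order and label them $1,2,\ldots,q,1,2,\ldots,q,\ldots$ cyclically (repeating the numbering from $1$ to $q$ if $|V|>q$). The new edges of $T(n+1,r,q)$ are exactly those joining $v$ to the vertices of $V$ labelled $1$; all edges of $T(n,r,q)$ are kept. By abuse of notation $T(n,r,q)$ also denotes the number of edges of this graph (which does not depend on the choices made). *)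

theory Defs
  imports Main
begin

text \<open>
  Schreier-type sets. The positive integers are \<open>{1..}\<close> in type \<^typ>\<open>nat\<close>. Only finite nonempty
  progressions are listed, since only subsets of \<open>{1..n}\<close> are ever counted.
\<close>

definition arith_prog :: "nat \<Rightarrow> nat set \<Rightarrow> bool" where
  "arith_prog q F \<longleftrightarrow> (\<exists>a j. F = {a + i * q | i. i \<le> j})"

definition AP_family :: "nat \<Rightarrow> nat set set" where
  "AP_family q = {F. F \<subseteq> {1..} \<and> (card F = 1 \<or> arith_prog q F)}"

definition Sr :: "nat \<Rightarrow> nat \<Rightarrow> nat \<Rightarrow> nat" where
  "Sr n p q = card {F. F \<subseteq> {1..n} \<and> p * Min F \<ge> card F \<and> F \<in> AP_family q}"

text \<open>
  A graph with \<open>r\<close> (possibly empty) parts is given by the parts \<open>P 0, \<dots>, P (r - 1)\<close>, whose union is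
  the vertex set, together with the set \<open>E\<close> of edges, an edge being a two-element set of vertices.

  \<open>T_choice r q n P i V\<close>: in a graph with \<open>n\<close> vertices and parts \<open>P\<close>, the new vertex may be put into
  part \<open>i\<close> with \<open>V\<close> as the selected set of old vertices. The comparison of \<open>k\<close> with \<open>r - q\<close> is
  written additively because subtraction on \<^typ>\<open>nat\<close> truncates.
\<close>

definition T_choice ::
  "nat \<Rightarrow> nat \<Rightarrow> nat \<Rightarrow> (nat \<Rightarrow> 'v set) \<Rightarrow> nat \<Rightarrow> 'v set \<Rightarrow> bool" where
  "T_choice r q n P i V \<longleftrightarrow> i < r \<and>
    (\<exists>l k. n = r * l + k \<and> 1 \<le> k \<and> k \<le> r \<and>
      (k = r \<and>
         (\<exists>j<r. j \<noteq> i \<and> V = (\<Union>m\<in>{..<r} - {j}. P m))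
     \<or> r < k + q \<and> k < r \<and> card (P i) = l \<and>
         (\<exists>j<r. card (P j) = l + 1 \<and> V = (\<Union>m\<in>{..<r} - {j}. P m))
     \<or> k + q \<le> r \<and> k < r \<and> card (P i) = l \<and>
         V = (\<Union>m\<in>{..<r} - {i}. P m)))"

text \<open>
  The vertices of \<open>V\<close> are listed as \<open>xs\<close>, and the vertex at (zero-based) position \<open>i\<close> receives the
  label \<open>i mod q + 1\<close>.
\<close>

definition cyclic_label :: "nat \<Rightarrow> nat \<Rightarrow> nat" where
  "cyclic_label q i = i mod q + 1"

definition new_edges :: "nat \<Rightarrow> 'v \<Rightarrow> 'v list \<Rightarrow> 'v set set" where
  "new_edges q v xs = {{v, xs ! i} | i. i < length xs \<and> cyclic_label q i = 1}"

text \<open>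
  \<open>T_graph r q n P E\<close>: the graph with parts \<open>P\<close> and edges \<open>E\<close> is one of the possible outcomes of
  the construction of \<open>T(n,r,q)\<close>, for some sequence of choices.
\<close>

inductive T_graph :: "nat \<Rightarrow> nat \<Rightarrow> nat \<Rightarrow> (nat \<Rightarrow> 'v set) \<Rightarrow> 'v set set \<Rightarrow> bool"
  for r q :: nat where
  base: "i < r \<Longrightarrow> T_graph r q 1 ((\<lambda>_. {})(i := {v})) {}"
| step: "T_graph r q n P E \<Longrightarrow> v \<notin> (\<Union>m<r. P m) \<Longrightarrow> T_choice r q n P i V \<Longrightarrow>
         distinct xs \<Longrightarrow> set xs = V \<Longrightarrow>
         T_graph r q (n + 1) (P(i := insert v (P i))) (E \<union> new_edges q v xs)"

end

theory Submission
  imports Defs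
begin

text \<open>
  Put \<open>r = p * q + 1\<close>. Both sides grow with \<open>n\<close> by the same amount, namely by
  \<open>\<lceil>p * m / r\<rceil>\<close> on passing from \<open>m - 1\<close> to \<open>m\<close> on the left and from \<open>m\<close> to \<open>m + 1\<close> vertices on
  the right, and both start at \<open>0\<close>. For positive \<open>x\<close> the number \<open>\<lceil>x / d\<rceil>\<close> is written
  \<open>(x - 1) div d + 1\<close> throughout.

  On the left, a new set is a progression \<open>{m - j * q, \<dots>, m}\<close>, and the condition
  \<open>j + 1 \<le> p * (m - j * q)\<close> says \<open>j * r < p * m\<close>, which leaves \<open>\<lceil>p * m / r\<rceil>\<close> values of \<open>j\<close>
  (\<open>Sr_Suc\<close>).

  On the right, the construction keeps the parts as equal in size as possible. So for
  \<open>m = r * l + k\<close> the size of \<open>V\<close> is \<open>m\<close> minus the size of one part, which is \<open>l\<close> or \<open>l + 1\<close>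
  as the case prescribes; the new vertex receives \<open>\<lceil>card V / q\<rceil>\<close> edges (\<open>card_new_edges\<close>).
  That \<open>\<lceil>card V / q\<rceil> = \<lceil>p * m / r\<rceil>\<close> is checked by trapping both fractions between the same
  two consecutive integers (\<open>T_choice_card\<close>). The case distinction in the construction is what
  makes this work: as \<open>m\<close> minus a part is about \<open>m * (r - 1) / r = q * (p * m / r)\<close>, the two
  fractions are close, and the choice between \<open>l\<close> and \<open>l + 1\<close> corrects the rounding.

  That some graph results at all (\<open>T_graph_exists\<close>) again rests on balance: as long as \<open>k < r\<close>,
  parts of both sizes \<open>l\<close> and \<open>l + 1\<close> occur, so the parts asked for by the construction exist.
\<close>

section \<open>Counting Schreier-type progressions\<close>

lemma pred_div_eqI:
  fixes t d x :: nat
  assumes "t * d < x" and "x \<le> (t + 1) * d"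
  shows "(x - 1) div d = t"
  using assms by (intro div_nat_eqI) (auto simp: algebra_simps)

definition progression :: "nat \<Rightarrow> nat \<times> nat \<Rightarrow> nat set" where
  "progression q = (\<lambda>(a, j). (\<lambda>i. a + i * q) ` {..j})"

lemma card_progression:
  assumes "q \<ge> 1"
  shows "card (progression q (a, j)) = j + 1"
  using assms by (simp add: progression_def card_image inj_on_def)

lemma Min_progression: "Min (progression q (a, j)) = a"
  unfolding progression_def by (intro Min_eqI) (auto intro: image_eqI[of _ _ 0])

text \<open>The sets that \<open>Sr n p q\<close> counts, each encoded by its minimum and its number of steps.\<close>

definition Schreier_params :: "nat \<Rightarrow> nat \<Rightarrow> nat \<Rightarrow> (nat \<times> nat) set" where
  "Schreier_params n p q = {(a, j). 1 \<le> a \<and> a + j * q \<le> n \<and> j + 1 \<le> p * a}"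

lemma finite_Schreier_params: "q \<ge> 1 \<Longrightarrow> finite (Schreier_params n p q)"
proof -
  assume q: "q \<ge> 1"
  have "Schreier_params n p q \<subseteq> {..n} \<times> {..n}"
  proof (rule subrelI)
    fix a j assume "(a, j) \<in> Schreier_params n p q"
    hence "a + j * q \<le> n" by (simp add: Schreier_params_def)
    moreover have "j \<le> j * q" using q by simp
    ultimately have "a \<le> n" "j \<le> n" by linarith+
    thus "(a, j) \<in> {..n} \<times> {..n}" by simp
  qed
  thus ?thesis by (rule finite_subset) simp
qed

lemma Sr_eq_card_params:
  assumes q: "q \<ge> 1"
  shows "Sr n p q = card (Schreier_params n p q)"
proof -
  have sub: "progression q (a, j) \<subseteq> {1..n} \<longleftrightarrow> 1 \<le> a \<and> a + j * q \<le> n" for a j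
  proof
    assume "progression q (a, j) \<subseteq> {1..n}"
    moreover have "a \<in> progression q (a, j)" "a + j * q \<in> progression q (a, j)"
      by (auto simp: progression_def intro: image_eqI[of _ _ 0])
    ultimately show "1 \<le> a \<and> a + j * q \<le> n" by auto
  next
    assume *: "1 \<le> a \<and> a + j * q \<le> n"
    have "a + i * q \<le> n" if "i \<le> j" for i
      using * mult_le_mono1[OF that, of q] by linarith
    with * show "progression q (a, j) \<subseteq> {1..n}" by (auto simp: progression_def)
  qed
  have arith: "arith_prog q F \<longleftrightarrow> (\<exists>a j. F = progression q (a, j))" for F
    unfolding arith_prog_def progression_def
    by (simp add: image_def Bex_def conj_commute)
  have single: "arith_prog q F" if one: "card F = 1" for F
  proof -
    obtain a where "F = {a}" using card_1_singletonE[OF one] .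
    hence "F = progression q (a, 0)" by (simp add: progression_def)
    thus ?thesis using arith by blast
  qed
  have "{F. F \<subseteq> {1..n} \<and> p * Min F \<ge> card F \<and> F \<in> AP_family q}
      = {F. F \<subseteq> {1..n} \<and> p * Min F \<ge> card F \<and> arith_prog q F}"
    using single by (auto simp: AP_family_def)
  also have "\<dots> = progression q ` Schreier_params n p q"
  proof (intro set_eqI iffI)
    fix F assume "F \<in> {F. F \<subseteq> {1..n} \<and> p * Min F \<ge> card F \<and> arith_prog q F}"
    then obtain a j where F: "F = progression q (a, j)" "F \<subseteq> {1..n}" "p * Min F \<ge> card F"
      using arith by auto
    hence "(a, j) \<in> Schreier_params n p q"
      using sub[of a j] by (simp add: Schreier_params_def card_progression[OF q] Min_progression)
    thus "F \<in> progression q ` Schreier_params n p q" using F(1) by blast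
  next
    fix F assume "F \<in> progression q ` Schreier_params n p q"
    then obtain a j where "F = progression q (a, j)" "(a, j) \<in> Schreier_params n p q"
      by auto
    thus "F \<in> {F. F \<subseteq> {1..n} \<and> p * Min F \<ge> card F \<and> arith_prog q F}"
      using sub[of a j] arith
      by (auto simp: Schreier_params_def card_progression[OF q] Min_progression)
  qed
  finally have "Sr n p q = card (progression q ` Schreier_params n p q)"
    by (simp add: Sr_def)
  also have "\<dots> = card (Schreier_params n p q)"
  proof (intro card_image inj_onI, clarify)
    fix a j b k assume "progression q (a, j) = progression q (b, k)"
    thus "a = b \<and> j = k"
      using card_progression[OF q, of a j] card_progression[OF q, of b k]
        Min_progression[of q a j] Min_progression[of q b k] by simp
  qed
  finally show ?thesis .
qed

text \<open>
  The sets that are new for \<open>n + 1\<close> are those with maximum \<open>n + 1\<close>, so the number of steps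
  determines them. The condition on the minimum bounds that number so strongly that the
  progression cannot leave the positive integers.
\<close>

lemma Sr_Suc:
  assumes p: "p \<ge> 1" and q: "q \<ge> 1"
  shows "Sr (Suc n) p q = Sr n p q + ((p * Suc n - 1) div (p * q + 1) + 1)"
proof -
  define m where "m = Suc n"
  define N where "N = (\<lambda>j. (m - j * q, j)) ` {..(p * m - 1) div (p * q + 1)}"
  have steps: "1 \<le> m - j * q \<and> j * q \<le> m \<and> j + 1 \<le> p * (m - j * q)
      \<longleftrightarrow> j \<le> (p * m - 1) div (p * q + 1)" for j
  proof -
    have "p * m \<ge> 1" using p by (simp add: m_def)
    have "j \<le> (p * m - 1) div (p * q + 1) \<longleftrightarrow> j * (p * q + 1) \<le> p * m - 1"
      by (simp add: less_eq_div_iff_mult_less_eq)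
    also have "\<dots> \<longleftrightarrow> p * (j * q) + j + 1 \<le> p * m"
    proof -
      have "j * (p * q + 1) = p * (j * q) + j" by (simp add: algebra_simps)
      thus ?thesis using \<open>p * m \<ge> 1\<close> by linarith
    qed
    also have "\<dots> \<longleftrightarrow> 1 \<le> m - j * q \<and> j * q \<le> m \<and> j + 1 \<le> p * (m - j * q)"
    proof
      assume *: "p * (j * q) + j + 1 \<le> p * m"
      hence "p * (j * q) < p * m" by linarith
      hence "j * q < m" by simp
      moreover have "j + 1 \<le> p * m - p * (j * q)" using * by linarith
      ultimately show "1 \<le> m - j * q \<and> j * q \<le> m \<and> j + 1 \<le> p * (m - j * q)"
        by (simp only: diff_mult_distrib2) auto
    next
      assume *: "1 \<le> m - j * q \<and> j * q \<le> m \<and> j + 1 \<le> p * (m - j * q)"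
      hence "p * (j * q) \<le> p * m" by simp
      moreover have "j + 1 \<le> p * m - p * (j * q)"
        using * by (simp only: diff_mult_distrib2)
      ultimately show "p * (j * q) + j + 1 \<le> p * m" by linarith
    qed
    finally show ?thesis by simp
  qed
  have split: "Schreier_params (Suc n) p q = Schreier_params n p q \<union> N"
  proof (intro set_eqI iffI; clarify)
    fix a j assume *: "(a, j) \<in> Schreier_params (Suc n) p q" "(a, j) \<notin> N"
    have "a + j * q \<noteq> m"
    proof
      assume eq: "a + j * q = m"
      hence a: "m - j * q = a" by simp
      hence "j \<le> (p * m - 1) div (p * q + 1)"
        using *(1) steps[of j] eq by (auto simp: Schreier_params_def)
      hence "(a, j) \<in> N" using a by (auto simp: N_def)
      thus False using *(2) by blast
    qed
    thus "(a, j) \<in> Schreier_params n p q" using *(1) by (auto simp: Schreier_params_def m_def)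
  next
    fix a j assume *: "(a, j) \<in> Schreier_params n p q \<union> N"
    show "(a, j) \<in> Schreier_params (Suc n) p q"
    proof (cases "(a, j) \<in> N")
      case True
      thus ?thesis using steps[of j] by (auto simp: N_def Schreier_params_def m_def)
    qed (use * in \<open>auto simp: Schreier_params_def\<close>)
  qed
  have disj: "Schreier_params n p q \<inter> N = {}"
    using steps by (fastforce simp: N_def Schreier_params_def m_def)
  have "card N = (p * m - 1) div (p * q + 1) + 1"
    unfolding N_def by (subst card_image) (auto simp: inj_on_def)
  thus ?thesis
    using split disj q finite_Schreier_params[OF q]
    by (simp add: Sr_eq_card_params card_Un_disjoint N_def m_def)
qed

lemma Sr_eq_sum:
  assumes "p \<ge> 1" and "q \<ge> 1"
  shows "Sr n p q = (\<Sum>m=1..n. (p * m - 1) div (p * q + 1) + 1)"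
proof (induction n)
  case 0
  have "Schreier_params 0 p q = {}" by (auto simp: Schreier_params_def)
  thus ?case by (simp add: Sr_eq_card_params[OF assms(2)])
next
  case (Suc n)
  thus ?case using Sr_Suc[OF assms, of n] by simp
qed

section \<open>Balanced partitions\<close>

definition balanced_parts :: "nat \<Rightarrow> nat \<Rightarrow> (nat \<Rightarrow> 'v set) \<Rightarrow> bool" where
  "balanced_parts r n P \<longleftrightarrow>
     (\<forall>i<r. finite (P i)) \<and> (\<forall>i<r. \<forall>j<r. i \<noteq> j \<longrightarrow> P i \<inter> P j = {}) \<and>
     (\<Sum>i<r. card (P i)) = n \<and> (\<forall>i<r. \<forall>j<r. card (P i) \<le> card (P j) + 1)"

text \<open>
  If one part had fewer than \<open>l\<close> vertices, then no part would have more than \<open>l\<close>, and the total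
  would be too small; likewise at the upper end.
\<close>

lemma balanced_parts_size:
  assumes bal: "balanced_parts r (r * l + k) P" and k: "1 \<le> k" "k \<le> r" and i: "i < r"
  shows "l \<le> card (P i)" and "card (P i) \<le> l + 1"
proof -
  have sum: "(\<Sum>i<r. card (P i)) = r * l + k"
    and le: "\<And>i j. i < r \<Longrightarrow> j < r \<Longrightarrow> card (P i) \<le> card (P j) + 1"
    using bal by (auto simp: balanced_parts_def)
  show "l \<le> card (P i)"
  proof (rule ccontr)
    assume *: "\<not> l \<le> card (P i)"
    have "(\<Sum>j<r. card (P j)) \<le> (\<Sum>j<r. l)"
      using le[OF _ i] * by (intro sum_mono) fastforce
    thus False using sum k by simp
  qed
  show "card (P i) \<le> l + 1"
  proof (rule ccontr)
    assume *: "\<not> card (P i) \<le> l + 1"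
    have ge: "l + 1 \<le> card (P j)" if "j < r" for j
      using le[OF i that] * by linarith
    have "(\<Sum>j<r. l + 1) < (\<Sum>j<r. card (P j))"
      by (rule sum_strict_mono_ex1) (use ge i * in \<open>auto simp: not_le\<close>)
    thus False using sum k by simp
  qed
qed

lemma balanced_parts_full:
  assumes bal: "balanced_parts r (r * l + r) P" and i: "i < r"
  shows "card (P i) = l + 1"
proof (rule ccontr)
  assume *: "card (P i) \<noteq> l + 1"
  have r: "1 \<le> r" using i by simp
  note size = balanced_parts_size(2)[OF bal r order.refl]
  have "(\<Sum>j<r. card (P j)) < (\<Sum>j<r. l + 1)"
    by (rule sum_strict_mono_ex1) (use size i * in \<open>auto simp: le_less\<close>)
  thus False using bal by (simp add: balanced_parts_def)
qed

lemma card_Union_except: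
  assumes bal: "balanced_parts r n P" and j: "j < r"
  shows "card (\<Union>m\<in>{..<r} - {j}. P m) = n - card (P j)"
proof -
  have "card (\<Union>m\<in>{..<r} - {j}. P m) = (\<Sum>m\<in>{..<r} - {j}. card (P m))"
    using bal by (intro card_UN_disjoint) (auto simp: balanced_parts_def)
  also have "\<dots> = n - card (P j)"
    using bal j by (simp add: balanced_parts_def sum_diff1_nat)
  finally show ?thesis .
qed

lemma balanced_parts_insert:
  assumes bal: "balanced_parts r n P" and i: "i < r" and v: "v \<notin> (\<Union>m<r. P m)"
    and smallest: "\<And>j. j < r \<Longrightarrow> card (P i) \<le> card (P j)"
  shows "balanced_parts r (n + 1) (P(i := insert v (P i)))"
proof -
  let ?Q = "P(i := insert v (P i))"
  have fin: "\<And>m. m < r \<Longrightarrow> finite (P m)"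
    and disj: "\<And>a b. a < r \<Longrightarrow> b < r \<Longrightarrow> a \<noteq> b \<Longrightarrow> P a \<inter> P b = {}"
    and sum: "(\<Sum>m<r. card (P m)) = n"
    and le: "\<And>a b. a < r \<Longrightarrow> b < r \<Longrightarrow> card (P a) \<le> card (P b) + 1"
    using bal by (auto simp: balanced_parts_def)
  have card: "card (?Q m) = card (P m) + (if m = i then 1 else 0)" if "m < r" for m
    using that v i fin by auto
  have "(\<Sum>m<r. card (?Q m)) = (\<Sum>m<r. card (P m) + (if m = i then 1 else 0))"
    by (rule sum.cong) (use card in auto)
  also have "\<dots> = n + 1" using i by (simp add: sum.distrib sum)
  finally have "(\<Sum>m<r. card (?Q m)) = n + 1" .
  moreover have "card (?Q a) \<le> card (?Q b) + 1" if "a < r" "b < r" for a b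
    using card[OF that(1)] card[OF that(2)] le[OF that] smallest[OF that(2)] by (auto split: if_splits)
  moreover have "?Q a \<inter> ?Q b = {}" if "a < r" "b < r" "a \<noteq> b" for a b
    using disj[OF that] v that by auto
  moreover have "finite (?Q m)" if "m < r" for m
    using fin[OF that] fin[OF i] by auto
  ultimately show ?thesis
    unfolding balanced_parts_def by blast
qed

section \<open>One step of the graph construction\<close>

lemma T_choice_smallest:
  assumes bal: "balanced_parts r n P" and ch: "T_choice r q n P i V" and j: "j < r"
  shows "card (P i) \<le> card (P j)"
proof -
  obtain l k where n: "n = r * l + k" and k: "1 \<le> k" "k \<le> r"
    and cases: "k = r \<or> card (P i) = l" and i: "i < r"
    using ch unfolding T_choice_def by blast
  show ?thesis
  proof (cases "k = r")
    case True
    thus ?thesis using balanced_parts_full[of r l P] bal i j n by simp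
  next
    case False
    thus ?thesis using cases balanced_parts_size(1)[of r l k P j] bal j n k by simp
  qed
qed

lemma T_choice_subset: "T_choice r q n P i V \<Longrightarrow> V \<subseteq> (\<Union>m<r. P m)"
  unfolding T_choice_def by auto

text \<open>
  In each case an integer \<open>t\<close> is named with \<open>t < card V / q \<le> t + 1\<close> and
  \<open>t < p * n / (p * q + 1) \<le> t + 1\<close>. Writing \<open>n = (p * q + 1) * l + k\<close>, the block \<open>l\<close>
  contributes exactly \<open>p * l\<close> to both fractions, so that only \<open>k\<close> matters.
\<close>

lemma T_choice_card:
  assumes p: "p \<ge> 1" and q: "q \<ge> 1" and bal: "balanced_parts (p * q + 1) n P"
    and ch: "T_choice (p * q + 1) q n P i V"
  shows "card V > 0" and "(card V - 1) div q = (p * n - 1) div (p * q + 1)"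
proof -
  let ?r = "p * q + 1"
  obtain p' where p': "p = p' + 1" using p by (metis le_add_diff_inverse2)
  have i: "i < ?r" using ch by (simp add: T_choice_def)
  obtain l k where n: "n = ?r * l + k" and k: "1 \<le> k" "k \<le> ?r" and choice:
      "(k = ?r \<and> (\<exists>j<?r. j \<noteq> i \<and> V = (\<Union>m\<in>{..<?r} - {j}. P m)))
     \<or> ?r < k + q \<and> k < ?r \<and> card (P i) = l \<and>
         (\<exists>j<?r. card (P j) = l + 1 \<and> V = (\<Union>m\<in>{..<?r} - {j}. P m))
     \<or> k + q \<le> ?r \<and> k < ?r \<and> card (P i) = l \<and> V = (\<Union>m\<in>{..<?r} - {i}. P m)"
    using ch unfolding T_choice_def by blast
  have "\<exists>t. t * q < card V \<and> card V \<le> (t + 1) * q \<and> t * ?r < p * n \<and> p * n \<le> (t + 1) * ?r"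
    using choice
  proof (elim disjE conjE exE)
    fix j assume "k = ?r" "j < ?r" "V = (\<Union>m\<in>{..<?r} - {j}. P m)"
    hence "card V = n - (l + 1)" and n': "n = ?r * (l + 1)"
      using card_Union_except[OF bal] balanced_parts_full[of ?r l P j] bal n by auto
    hence "card V = (p * l + p) * q" by (simp add: algebra_simps)
    moreover have "p * n = (p * l + p) * ?r" by (simp add: n' algebra_simps)
    moreover have "(p * l + p') * q < (p * l + p) * q" "(p * l + p') * ?r < (p * l + p) * ?r"
      using q p' by (simp_all only: mult_less_cancel2) auto
    ultimately show ?thesis
      by (intro exI[of _ "p * l + p'"]) (simp add: p' add.assoc)
  next
    fix j assume k2: "?r < k + q" "k < ?r" and "j < ?r" "card (P j) = l + 1"
      "V = (\<Union>m\<in>{..<?r} - {j}. P m)"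
    hence V: "card V = n - (l + 1)" using card_Union_except[OF bal] by auto
    have "p' * q + 2 \<le> k" using k2 by (simp add: p' algebra_simps)
    then obtain e where e: "k = p' * q + 2 + e" using le_Suc_ex by blast
    have eq: "e + 2 \<le> q" using k2(2) by (simp add: e p' algebra_simps)
    have "card V = (p * l + p') * q + 1 + e"
      using V by (simp add: n e algebra_simps)
    moreover have "p * n = (p * l + p') * ?r + (p' + 2 + p * e)"
      by (simp add: n e p' algebra_simps)
    moreover have "p * n \<le> (p * l + p' + 1) * ?r"
    proof -
      have "p * k \<le> p * ?r" using k(2) by (rule mult_le_mono2)
      thus ?thesis by (simp add: n p' algebra_simps)
    qed
    ultimately show ?thesis using eq
      by (intro exI[of _ "p * l + p'"]) (auto simp: algebra_simps)
  next
    assume k3: "k + q \<le> ?r" "card (P i) = l" "V = (\<Union>m\<in>{..<?r} - {i}. P m)"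
    hence V: "card V = n - l" using card_Union_except[OF bal i] by auto
    define s where "s = (k - 1) div q"
    define e where "e = (k - 1) mod q"
    have ks: "k = s * q + 1 + e" using k(1) div_mult_mod_eq[of "k - 1" q] by (simp add: s_def e_def)
    have eq: "e + 1 \<le> q" using q by (simp add: e_def Suc_leI)
    have "s * q \<le> p' * q" using k3(1) unfolding ks p' add_mult_distrib by linarith
    hence sp: "s + 1 \<le> p" using q by (simp add: p')
    have "card V = (p * l + s) * q + 1 + e"
      using V by (simp add: n ks algebra_simps)
    moreover have pn: "p * n = p * l * ?r + s * (p * q) + p * (e + 1)"
      by (simp add: n ks algebra_simps)
    moreover have "(p * l + s) * ?r < p * n"
    proof -
      have "s < p * (e + 1)" using sp by (simp add: trans_less_add1)
      thus ?thesis unfolding pn by (simp add: algebra_simps)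
    qed
    moreover have "p * n \<le> (p * l + s + 1) * ?r"
    proof -
      have "p * (e + 1) \<le> p * q" using eq by (rule mult_le_mono2)
      thus ?thesis unfolding pn by (simp add: algebra_simps)
    qed
    ultimately show ?thesis using eq
      by (intro exI[of _ "p * l + s"]) (auto simp: algebra_simps)
  qed
  then obtain t where t: "t * q < card V" "card V \<le> (t + 1) * q" "t * ?r < p * n"
      "p * n \<le> (t + 1) * ?r"
    by blast
  show "card V > 0" using t(1) by linarith
  show "(card V - 1) div q = (p * n - 1) div ?r"
    using pred_div_eqI[OF t(1,2)] pred_div_eqI[OF t(3,4)] by simp
qed

lemma card_new_edges:
  assumes q: "q \<ge> 1" and dist: "distinct xs" and ne: "length xs > 0"
  shows "card (new_edges q v xs) = (length xs - 1) div q + 1"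
proof -
  let ?I = "{i. i < length xs \<and> cyclic_label q i = 1}"
  have "new_edges q v xs = (\<lambda>i. {v, xs ! i}) ` ?I"
    by (auto simp: new_edges_def)
  moreover have "inj_on (\<lambda>i. {v, xs ! i}) ?I"
    using dist by (auto simp: inj_on_def doubleton_eq_iff nth_eq_iff_index_eq)
  ultimately have "card (new_edges q v xs) = card ?I"
    by (simp add: card_image)
  also have "?I = (\<lambda>t. t * q) ` {..(length xs - 1) div q}"
  proof (intro set_eqI iffI)
    fix i assume "i \<in> ?I"
    hence "i \<le> length xs - 1" "i = i div q * q"
      by (auto simp: cyclic_label_def)
    thus "i \<in> (\<lambda>t. t * q) ` {..(length xs - 1) div q}"
      by (metis atMost_iff div_le_mono image_eqI)
  next
    fix i assume "i \<in> (\<lambda>t. t * q) ` {..(length xs - 1) div q}"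
    then obtain t where "i = t * q" "t \<le> (length xs - 1) div q" by blast
    moreover from this have "t * q \<le> length xs - 1"
      using q by (simp add: less_eq_div_iff_mult_less_eq)
    hence "t * q < length xs" using ne by linarith
    ultimately show "i \<in> ?I" by (simp add: cyclic_label_def)
  qed
  also have "card \<dots> = (length xs - 1) div q + 1"
    using q by (subst card_image) (auto simp: inj_on_def)
  finally show ?thesis .
qed

section \<open>The number of edges\<close>

lemma T_graph_balanced:
  assumes "T_graph r q n P E"
  shows "balanced_parts r n P"
  using assms
proof induction
  case (base i v)
  have "(\<Sum>m<r. card (((\<lambda>_. {})(i := {v})) m)) = (\<Sum>m<r. if m = i then 1 else 0)"
    by (rule sum.cong) auto
  thus ?case using base by (auto simp: balanced_parts_def)
next
  case (step n P E v i V xs)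
  show ?case
    using step.IH step.hyps(2) T_choice_smallest[OF step.IH step.hyps(3)] step.hyps(3)
    by (intro balanced_parts_insert) (auto simp: T_choice_def)
qed

lemma T_graph_edges:
  assumes "T_graph r q n P E"
  shows "finite E" and "\<Union>E \<subseteq> (\<Union>m<r. P m)"
  using assms
proof induction
  case (step n P E v i V xs)
  {
    case 1
    show ?case using step.IH(1) by (simp add: new_edges_def)
  next
    case 2
    have "\<Union>(new_edges q v xs) \<subseteq> insert v V"
      using step.hyps by (auto simp: new_edges_def)
    moreover have "V \<subseteq> (\<Union>m<r. P m)" using step.hyps(3) by (rule T_choice_subset)
    moreover have "i < r" using step.hyps(3) by (simp add: T_choice_def)
    moreover from this have "(\<Union>m<r. (P(i := insert v (P i))) m) = insert v (\<Union>m<r. P m)"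
      by (auto split: if_splits)
    ultimately show ?case using step.IH(2) by auto
  }
qed auto

lemma T_graph_card_edges:
  assumes p: "p \<ge> 1" and q: "q \<ge> 1" and "T_graph (p * q + 1) q n P E"
  shows "card E = (\<Sum>m=1..<n. (p * m - 1) div (p * q + 1) + 1)"
  using assms(3)
proof induction
  case (step n P E v i V xs)
  note bal = T_graph_balanced[OF step.hyps(1)]
  note V = T_choice_card[OF p q bal step.hyps(3)]
  have len: "length xs = card V"
    using step.hyps(4,5) distinct_card by force
  have "card (new_edges q v xs) = (p * n - 1) div (p * q + 1) + 1"
    using card_new_edges[OF q step.hyps(4), of v] V len by simp
  moreover have "E \<inter> new_edges q v xs = {}"
    using T_graph_edges(2)[OF step.hyps(1)] step.hyps(2) by (auto simp: new_edges_def)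
  moreover have "finite (new_edges q v xs)" by (simp add: new_edges_def)
  ultimately have "card (E \<union> new_edges q v xs) = card E + ((p * n - 1) div (p * q + 1) + 1)"
    using T_graph_edges(1)[OF step.hyps(1)] by (simp add: card_Un_disjoint)
  moreover have "n \<ge> 1" using step.hyps(1) by (induction) auto
  ultimately show ?case using step.IH by simp
qed auto

section \<open>The construction never gets stuck\<close>

lemma T_choice_exists:
  assumes r: "r \<ge> 2" and n: "n \<ge> 1" and bal: "balanced_parts r n P"
  shows "\<exists>i V. T_choice r q n P i V"
proof -
  \<comment> \<open>The remainder \<open>k\<close> lies in \<open>{1..r}\<close>, so the division is that of \<open>n - 1\<close>.\<close>
  define l where "l = (n - 1) div r"
  define k where "k = (n - 1) mod r + 1"
  have nk: "n = r * l + k" and k: "1 \<le> k" "k \<le> r"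
    using n r by (auto simp: l_def k_def Suc_leI)
  have sum: "(\<Sum>m<r. card (P m)) = r * l + k"
    using bal nk by (simp add: balanced_parts_def)
  show ?thesis
  proof (cases "k = r")
    case True
    have "0 < r" "1 < r" "(1::nat) \<noteq> 0" using r by auto
    hence "T_choice r q n P 0 (\<Union>m\<in>{..<r} - {1}. P m)"
      unfolding T_choice_def using True nk k by blast
    thus ?thesis by blast
  next
    case False
    note size = balanced_parts_size[OF bal[unfolded nk] k]
    have "\<exists>i<r. card (P i) = l"
    proof (rule ccontr)
      assume none: "\<not> (\<exists>i<r. card (P i) = l)"
      have "card (P m) \<ge> l + 1" if "m < r" for m
        using size(1)[OF that] none that by (auto simp: le_less)
      hence "(\<Sum>m<r. card (P m)) \<ge> (\<Sum>m<r. l + 1)" by (intro sum_mono) auto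
      thus False using sum False k by simp
    qed
    then obtain i where i: "i < r" "card (P i) = l" by blast
    have "\<exists>j<r. card (P j) = l + 1"
    proof (rule ccontr)
      assume none: "\<not> (\<exists>j<r. card (P j) = l + 1)"
      have "card (P m) \<le> l" if "m < r" for m
        using size(2)[OF that] none that by (auto simp: le_Suc_eq)
      hence "(\<Sum>m<r. card (P m)) \<le> (\<Sum>m<r. l)" by (intro sum_mono) auto
      thus False using sum k by simp
    qed
    then obtain j where j: "j < r" "card (P j) = l + 1" by blast
    have "k < r" using False k(2) by simp
    show ?thesis
    proof (cases "r < k + q")
      case True
      hence "T_choice r q n P i (\<Union>m\<in>{..<r} - {j}. P m)"
        unfolding T_choice_def using \<open>k < r\<close> i j nk k by blast
      thus ?thesis by blast
    next
      case False
      hence "k + q \<le> r" by simp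
      hence "T_choice r q n P i (\<Union>m\<in>{..<r} - {i}. P m)"
        unfolding T_choice_def using \<open>k < r\<close> i nk k by blast
      thus ?thesis by blast
    qed
  qed
qed

lemma T_graph_exists:
  assumes r: "r \<ge> 2"
  shows "\<exists>(P :: nat \<Rightarrow> nat set) E. T_graph r q (n + 1) P E"
proof (induction n)
  case 0
  have "T_graph r q 1 ((\<lambda>_. {})(0 := {0 :: nat})) {}"
    by (rule T_graph.base) (use r in simp)
  thus ?case by auto
next
  case (Suc n)
  then obtain P :: "nat \<Rightarrow> nat set" and E where G: "T_graph r q (n + 1) P E" by blast
  note bal = T_graph_balanced[OF G]
  have fin: "finite (\<Union>m<r. P m)" using bal by (auto simp: balanced_parts_def)
  then obtain v where v: "v \<notin> (\<Union>m<r. P m)"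
    using ex_new_if_finite[OF infinite_UNIV_nat] by blast
  obtain i V where ch: "T_choice r q (n + 1) P i V"
    using T_choice_exists[OF r _ bal, of q] by auto
  obtain xs where "set xs = V" "distinct xs"
    using finite_distinct_list finite_subset[OF T_choice_subset[OF ch] fin] by blast
  from T_graph.step[OF G v ch this(2,1)] show ?case by auto
qed

theorem theorem1p1:
  fixes p q n :: nat
  assumes "p \<ge> 1" and "q \<ge> 1" and "n \<ge> 1"
  shows "(\<exists>(P :: nat \<Rightarrow> nat set) E. T_graph (p * q + 1) q (n + 1) P E) \<and>
         (\<forall>(P :: nat \<Rightarrow> 'v set) E. T_graph (p * q + 1) q (n + 1) P E \<longrightarrow> Sr n p q = card E)"
proof (intro conjI allI impI)
  have "p * q + 1 \<ge> 2" using assms by (simp add: Suc_leI)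
  thus "\<exists>(P :: nat \<Rightarrow> nat set) E. T_graph (p * q + 1) q (n + 1) P E"
    by (rule T_graph_exists)
next
  fix P :: "nat \<Rightarrow> 'v set" and E
  assume "T_graph (p * q + 1) q (n + 1) P E"
  from T_graph_card_edges[OF assms(1,2) this] show "Sr n p q = card E"
    by (simp add: Sr_eq_sum[OF assms(1,2)] atLeastLessThanSuc_atLeastAtMost)
qed

end
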